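(* Let $1\le q\le\alpha\le p\le\infty$ with $q=\alpha$ or $\alpha=p$. Then there is a constant $C>0$ such that $\|f\|_\alpha\le C\|f\|_{q,p,\alpha}$ for all $f\in L_0(X)$.
   Context: Setting. $(X,d,\mu)$ is a space of homogeneous type: $d$ is a quasi-metric on $X$ (with a constant $\kappa\ge 1$ such that $d(x,y)\le\kappa(d(x,z)+d(z,y))$ for all $x,y,z\in X$), and $\mu$ is a non-negative Borel measure such that, with $B(x,r)=\{y\in X: d(x,y)<r\}$, there is a constant $C$ with $0<\mu(B(x,2r))\le C\mu(B(x,r))<\infty$ for all $x\in X$, $r>0$. It is assumed moreover that all balls $B(x,r)$ are open for the $d$-topology, $(X,d)$ is separable, $\mu(X)=\infty$, and $B(x,R)\setminus B(x,r)\neq\emptyset$ for all $x\in X$ and $0<r<R<\infty$. Notation. $L_0(X)$ is the complex vector space of classes (modulo equality $\mu$-almost everywhere) of $\mu$-measurable complex-valued functions on $X$; $\|\cdot\|_s$ is the usual norm of $L^s(X)=L^s(X,\mu)$ (with value $\infty$ outside $L^s(X)$); $\chi_E$ is the characteristic function of $E$. For $f\in L_0(X)$ and $r>0$ (convention $1/\infty=0$), $${}_{r}\|f\|_{q,p,\alpha}=\left[\int_X\left(\mu(B(y,r))^{\frac1\alpha-\frac1p-\frac1q}\,\|f\chi_{B(y,r)}\|_q\right)^p d\mu(y)\right]^{1/p}\quad\text{if } p<\infty,$$ $${}_{r}\|f\|_{q,\infty,\alpha}=\sup_{y\in X}\mu(B(y,r))^{\frac1\alpha-\frac1q}\,\|f\chi_{B(y,r)}\|_q\quad\text{if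 } p=\infty,$$ and $\|f\|_{q,p,\alpha}=\sup_{r>0}\ {}_{r}\|f\|_{q,p,\alpha}\in[0,\infty]$. *)

theory Defs
  imports "HOL-Analysis.Analysis" "HOL-Probability.Essential_Supremum"
begin

definition qball :: "'a set \<Rightarrow> ('a \<Rightarrow> 'a \<Rightarrow> real) \<Rightarrow> 'a \<Rightarrow> real \<Rightarrow> 'a set" where
  "qball X d x r = {y \<in> X. d x y < r}"

definition qtopology :: "'a set \<Rightarrow> ('a \<Rightarrow> 'a \<Rightarrow> real) \<Rightarrow> 'a topology" where
  "qtopology X d = topology (\<lambda>U. U \<subseteq> X \<and> (\<forall>x\<in>U. \<exists>r>0. qball X d x r \<subseteq> U))"

lemma openin_qtopology:
  "openin (qtopology X d) U \<longleftrightarrow> U \<subseteq> X \<and> (\<forall>x\<in>U. \<exists>r>0. qball X d x r \<subseteq> U)"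
proof -
  have "istopology (\<lambda>U. U \<subseteq> X \<and> (\<forall>x\<in>U. \<exists>r>0. qball X d x r \<subseteq> U))"
    unfolding istopology_def
  proof (intro conjI allI impI)
    fix S T
    assume S: "S \<subseteq> X \<and> (\<forall>x\<in>S. \<exists>r>0. qball X d x r \<subseteq> S)"
      and T: "T \<subseteq> X \<and> (\<forall>x\<in>T. \<exists>r>0. qball X d x r \<subseteq> T)"
    show "S \<inter> T \<subseteq> X" using S by blast
    show "\<forall>x\<in>S \<inter> T. \<exists>r>0. qball X d x r \<subseteq> S \<inter> T"
    proof
      fix x assume "x \<in> S \<inter> T"
      then obtain r s where "r > 0" "qball X d x r \<subseteq> S" "s > 0" "qball X d x s \<subseteq> T"
        using S T by blast
      then have "min r s > 0" "qball X d x (min r s) \<subseteq> S \<inter> T"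
        by (auto simp: qball_def)
      then show "\<exists>r>0. qball X d x r \<subseteq> S \<inter> T" by blast
    qed
  next
    fix \<K>
    assume K: "\<forall>U\<in>\<K>. U \<subseteq> X \<and> (\<forall>x\<in>U. \<exists>r>0. qball X d x r \<subseteq> U)"
    show "\<Union>\<K> \<subseteq> X" using K by blast
    show "\<forall>x\<in>\<Union>\<K>. \<exists>r>0. qball X d x r \<subseteq> \<Union>\<K>" using K by (meson UnionE Union_upper subset_trans)
  qed
  then show ?thesis
    by (simp add: qtopology_def)
qed

locale quasi_metric_space =
  fixes X :: "'a set" and d :: "'a \<Rightarrow> 'a \<Rightarrow> real"
  assumes nonneg: "\<And>x y. x \<in> X \<Longrightarrow> y \<in> X \<Longrightarrow> 0 \<le> d x y"
    and zero_iff: "\<And>x y. x \<in> X \<Longrightarrow> y \<in> X \<Longrightarrow> d x y = 0 \<longleftrightarrow> x = y"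
    and commute: "\<And>x y. x \<in> X \<Longrightarrow> y \<in> X \<Longrightarrow> d x y = d y x"
    and quasi_triangle: "\<exists>\<kappa>\<ge>1. \<forall>x\<in>X. \<forall>y\<in>X. \<forall>z\<in>X. d x y \<le> \<kappa> * (d x z + d z y)"

text \<open>The underlying set is \<^term>\<open>space M\<close>, and \<^term>\<open>M\<close> is a measure on the
  Borel \<open>\<sigma>\<close>-algebra of the \<open>d\<close>-topology.\<close>

locale homogeneous_type_space = quasi_metric_space "space M" d
  for d :: "'a \<Rightarrow> 'a \<Rightarrow> real" and M :: "'a measure" +
  assumes sets_eq_borel: "sets M = sigma_sets (space M) {U. openin (qtopology (space M) d) U}"
    and doubling: "\<exists>C::real. \<forall>x\<in>space M. \<forall>r>0.
        0 < emeasure M (qball (space M) d x (2 * r)) \<and>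
        emeasure M (qball (space M) d x (2 * r)) \<le> ennreal C * emeasure M (qball (space M) d x r) \<and>
        ennreal C * emeasure M (qball (space M) d x r) < \<infinity>"
    and openin_qball: "\<And>x r. x \<in> space M \<Longrightarrow> 0 < r \<Longrightarrow>
        openin (qtopology (space M) d) (qball (space M) d x r)"
    and separable: "separable_space (qtopology (space M) d)"
    and infinite_measure: "emeasure M (space M) = \<infinity>"
    and annulus_nonempty: "\<And>x r R. x \<in> space M \<Longrightarrow> 0 < r \<Longrightarrow> r < R \<Longrightarrow>
        qball (space M) d x R - qball (space M) d x r \<noteq> {}"

text \<open>Power with exponent \<open>s > 0\<close> on \<open>[0,\<infinity>]\<close>.\<close>

definition enn_powr :: "ennreal \<Rightarrow> real \<Rightarrow> ennreal" where
  "enn_powr a s = (if a = \<infinity> then \<infinity> else ennreal (enn2real a powr s))"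

text \<open>Exponents lie in \<open>[1,\<infinity>]\<close>; the reciprocal is a real number, so that differences of
  reciprocals are not truncated. Since \<open>inverse \<infinity> = 0\<close> in \<^typ>\<open>ennreal\<close>, this gives \<open>1/\<infinity> = 0\<close>.\<close>

definition recip :: "ennreal \<Rightarrow> real" where
  "recip s = enn2real (inverse s)"

text \<open>\<open>\<mu>\<close>-measurable functions are those in \<^term>\<open>borel_measurable (completion M)\<close>. The
  completion is needed because \<^const>\<open>esssup\<close> is \<open>\<infinity>\<close> on functions that are not measurable.\<close>

definition Lnorm :: "'a measure \<Rightarrow> ennreal \<Rightarrow> ('a \<Rightarrow> complex) \<Rightarrow> ennreal" where
  "Lnorm M s f =
    (if s = \<infinity> then esssup (completion M) (\<lambda>x. ennreal (norm (f x)))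
     else enn_powr (\<integral>\<^sup>+x. ennreal (norm (f x) powr enn2real s) \<partial>completion M) (recip s))"

text \<open>Balls have positive finite measure in a space of homogeneous type, so their measure may be
  taken as a real number and raised to an exponent of arbitrary sign.\<close>

definition fmean_norm_at ::
  "('a \<Rightarrow> 'a \<Rightarrow> real) \<Rightarrow> 'a measure \<Rightarrow> real \<Rightarrow> ennreal \<Rightarrow> ennreal \<Rightarrow> ennreal \<Rightarrow> ('a \<Rightarrow> complex) \<Rightarrow> ennreal" where
  "fmean_norm_at d M r q p \<alpha> f =
    (if p = \<infinity> then
       (SUP y\<in>space M.
          ennreal (measure M (qball (space M) d y r) powr (recip \<alpha> - recip q)) *
          Lnorm M q (\<lambda>x. f x * indicator (qball (space M) d y r) x))
     else
       enn_powr
         (\<integral>\<^sup>+y. enn_powr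
            (ennreal (measure M (qball (space M) d y r) powr (recip \<alpha> - recip p - recip q)) *
             Lnorm M q (\<lambda>x. f x * indicator (qball (space M) d y r) x))
            (enn2real p) \<partial>M)
         (recip p))"

definition fmean_norm ::
  "('a \<Rightarrow> 'a \<Rightarrow> real) \<Rightarrow> 'a measure \<Rightarrow> ennreal \<Rightarrow> ennreal \<Rightarrow> ennreal \<Rightarrow> ('a \<Rightarrow> complex) \<Rightarrow> ennreal" where
  "fmean_norm d M q p \<alpha> f = (SUP r\<in>{0<..}. fmean_norm_at d M r q p \<alpha> f)"

end

theory Submission
  imports Defs
begin

text \<open>
  For \<open>q < \<infinity>\<close> write \<open>A f y r\<close> for \<open>\<mu>(B(y,r))\<^sup>-\<^sup>1\<^sup>/\<^sup>q \<parallel>f \<chi>\<^bsub>B(y,r)\<^esub>\<parallel>\<^sub>q\<close>, the \<open>L\<^sup>q\<close> mean of \<open>f\<close> over a ball. The two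
  cases of the hypothesis are settled at opposite scales.

  \<^item> If \<open>q = \<alpha>\<close>, large radii suffice. Fix a ball \<open>W\<close> of radius \<open>R\<close> and take \<open>r = 2\<kappa>R\<close>. For every
    \<open>y \<in> W\<close> the ball \<open>B(y,r)\<close> contains \<open>W\<close>, and by doubling its measure is at most a constant times
    \<open>\<mu>(W)\<close>. So the integrand that defines the norm with radius \<open>r\<close> is, on all of \<open>W\<close>, at least a
    constant times \<open>\<mu>(W)\<^sup>-\<^sup>1 \<parallel>f \<chi>\<^sub>W\<parallel>\<^sub>\<alpha>\<^sup>p\<close>, and integrating over \<open>W\<close> alone recovers \<open>\<parallel>f \<chi>\<^sub>W\<parallel>\<^sub>\<alpha>\<close>
    up to a constant that depends neither on \<open>R\<close> nor on \<open>f\<close>. For \<open>p = \<infinity>\<close> the ball \<open>W\<close> is one of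
    the balls in the supremum.

  \<^item> If \<open>\<alpha> = p\<close> and \<open>q < \<infinity>\<close>, the norm with radius \<open>r\<close> is the \<open>L\<^sup>p\<close> norm (for \<open>p = \<infinity>\<close>,
    the supremum) of \<open>y \<mapsto> A f y r\<close>, and small radii suffice:
    at almost every point the means should recover at least \<open>\<bar>f\<bar>/2\<close> as \<open>r\<close> tends to \<open>0\<close>.

  In both cases the bound is proved for \<open>f \<chi>\<^sub>W\<close>, and monotone convergence along growing balls \<open>W\<close>
  removes the cut-off (\<open>Lnorm_le_exhaust\<close>).

  The second case rests on a weak form of the Lebesgue density theorem (\<open>eventually_half_density\<close>):
  for a bounded Borel set \<open>A\<close> and all small \<open>r\<close>, outside a set of small measure every \<open>y \<in> A\<close>
  satisfies \<open>\<mu>(B(y,r)) \<le> 2 \<mu>(A \<inter> B(y,r))\<close>. The proof uses one scale at a time. By outer regularity \<open>A\<close>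
  lies in an open set \<open>U\<close> that is barely larger, and for small \<open>r\<close> most balls \<open>B(y,r)\<close> centred in \<open>U\<close>
  stay inside \<open>U\<close>. Among the balls of radius \<open>r\<close> inside \<open>U\<close>, centred in \<open>A\<close>, that fail the density
  bound, choose a maximal disjoint family: its dilates cover all failing centres, and each of its members has at
  least half of its mass in \<open>U - A\<close>, so doubling bounds the measure of the failing set by a constant
  times \<open>\<mu>(U - A)\<close>. If \<open>\<bar>f\<bar> \<ge> t\<close> on \<open>A\<close>, the density bound at \<open>y\<close> forces \<open>A f y r \<ge> t/2\<close>
  (\<open>half_le_mean\<close>). For finite \<open>p\<close> this is applied to the finitely many level sets of a simple function
  below \<open>\<bar>f\<bar>\<^sup>p\<close>; for \<open>p = \<infinity>\<close> a single level set of positive measure is enough.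

  It is not clear that \<open>y \<mapsto> A f y r\<close> is measurable; where it is not, the integral in its norm is only a
  lower integral, to which Fatou's lemma does not apply. This is why the argument compares the means
  with explicit measurable functions at one fixed radius, instead of passing to a pointwise limit.
\<close>

section \<open>Powers, exponents and Lebesgue norms\<close>

lemma enn_powr_simps [simp]:
  "enn_powr 0 s = 0"
  "enn_powr top s = top"
  by (simp_all add: enn_powr_def)

lemma enn_powr_ennreal: "0 \<le> a \<Longrightarrow> enn_powr (ennreal a) s = ennreal (a powr s)"
  by (simp add: enn_powr_def)

lemma enn_powr_mono:
  assumes "0 \<le> s" "a \<le> b"
  shows "enn_powr a s \<le> enn_powr b s"
proof (cases "b = top")
  case False
  with assms have "a \<noteq> top" by (auto simp: top_unique)
  with False assms show ?thesis
    by (auto simp: enn_powr_def less_top intro!: ennreal_leI powr_mono2 enn2real_mono)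
qed simp

lemma enn_powr_eq_0_iff: "enn_powr a s = 0 \<longleftrightarrow> a = 0"
  by (cases a) (auto simp: enn_powr_ennreal)

lemma enn_powr_mult: "enn_powr (a * b) s = enn_powr a s * enn_powr b s"
proof (cases "a = top \<or> b = top")
  case True
  then show ?thesis
    by (cases "a = 0 \<or> b = 0") (auto simp: ennreal_mult_top ennreal_top_mult enn_powr_eq_0_iff)
next
  case False
  then obtain x y where "a = ennreal x" "b = ennreal y" "0 \<le> x" "0 \<le> y"
    by (cases a; cases b) auto
  then show ?thesis
    by (simp add: ennreal_mult[symmetric] enn_powr_ennreal powr_mult)
qed

lemma enn_powr_powr:
  "enn_powr (enn_powr a s) t = enn_powr a (s * t)"
  by (cases a) (auto simp: enn_powr_def powr_powr)

lemma enn_powr_one [simp]: "enn_powr a 1 = a"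
  by (cases a) (auto simp: enn_powr_def)

text \<open>This is how norm bounds are turned into bounds on integrals, so that roots rarely have to be
  manipulated below.\<close>
lemma enn_powr_inverse_le_iff:
  assumes "0 < s"
  shows "enn_powr a (1 / s) \<le> b \<longleftrightarrow> a \<le> enn_powr b s"
proof
  assume "enn_powr a (1 / s) \<le> b"
  from enn_powr_mono[OF _ this, of s] assms show "a \<le> enn_powr b s"
    by (simp add: enn_powr_powr)
next
  assume "a \<le> enn_powr b s"
  from enn_powr_mono[OF _ this, of "1 / s"] assms show "enn_powr a (1 / s) \<le> b"
    by (simp add: enn_powr_powr)
qed

lemma recip_top [simp]: "recip \<infinity> = 0" "recip top = 0"
  by (simp_all add: recip_def)

lemma recip_ennreal: "0 < s \<Longrightarrow> recip (ennreal s) = 1 / s"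
  by (simp add: recip_def inverse_ennreal inverse_eq_divide)

lemma Lnorm_cong_AE:
  assumes "f \<in> borel_measurable (completion M)" "g \<in> borel_measurable (completion M)"
    and AE: "AE x in M. norm (f x) = norm (g x)"
  shows "Lnorm M s f = Lnorm M s g"
proof -
  have AE': "AE x in completion M. norm (f x) = norm (g x)"
    using AE by (rule AE_completion)
  have "esssup (completion M) (\<lambda>x. ennreal (norm (f x))) = esssup (completion M) (\<lambda>x. ennreal (norm (g x)))"
    using assms AE' by (intro esssup_AE_cong) (auto elim: eventually_mono)
  moreover have "(\<integral>\<^sup>+x. ennreal (norm (f x) powr S) \<partial>completion M) = (\<integral>\<^sup>+x. ennreal (norm (g x) powr S) \<partial>completion M)" for S
    using AE' by (intro nn_integral_cong_AE) auto
  ultimately show ?thesis by (simp add: Lnorm_def)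
qed

lemma Lnorm_ennreal:
  "0 < S \<Longrightarrow> Lnorm M (ennreal S) f = enn_powr (\<integral>\<^sup>+x. ennreal (norm (f x) powr S) \<partial>M) (1 / S)"
  by (simp add: Lnorm_def recip_ennreal nn_integral_completion)

lemma Lnorm_le_iff:
  "0 < S \<Longrightarrow> Lnorm M (ennreal S) f \<le> K \<longleftrightarrow> (\<integral>\<^sup>+x. ennreal (norm (f x) powr S) \<partial>M) \<le> enn_powr K S"
  by (simp add: Lnorm_ennreal enn_powr_inverse_le_iff)

lemma Lnorm_top_le_iff:
  assumes "f \<in> borel_measurable M"
  shows "Lnorm M \<infinity> f \<le> K \<longleftrightarrow> (AE x in M. ennreal (norm (f x)) \<le> K)"
proof
  assume "Lnorm M \<infinity> f \<le> K"
  moreover have "AE x in completion M. ennreal (norm (f x)) \<le> Lnorm M \<infinity> f"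
    unfolding Lnorm_def by (simp add: esssup_AE)
  ultimately show "AE x in M. ennreal (norm (f x)) \<le> K"
    unfolding AE_completion_iff by (auto elim!: eventually_mono)
next
  assume "AE x in M. ennreal (norm (f x)) \<le> K"
  moreover have "(\<lambda>x. ennreal (norm (f x))) \<in> borel_measurable (completion M)"
    using assms by (intro measurable_completion) auto
  ultimately show "Lnorm M \<infinity> f \<le> K"
    unfolding Lnorm_def by (auto intro!: esssup_I AE_completion)
qed

lemma exponent_cases:
  assumes "1 \<le> (s::ennreal)"
  obtains "s = \<infinity>" | S where "1 \<le> S" "s = ennreal S"
  using assms by (cases s) auto

lemma Lnorm_mono:
  assumes "f \<in> borel_measurable M" "g \<in> borel_measurable M" "1 \<le> s"
    and "\<And>x. x \<in> space M \<Longrightarrow> norm (f x) \<le> norm (g x)"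
  shows "Lnorm M s f \<le> Lnorm M s g"
  using assms(3)
proof (cases rule: exponent_cases)
  case 1
  have "AE x in M. ennreal (norm (g x)) \<le> Lnorm M \<infinity> g"
    using Lnorm_top_le_iff[OF assms(2), of "Lnorm M \<infinity> g"] by simp
  then have "AE x in M. ennreal (norm (f x)) \<le> Lnorm M \<infinity> g"
    using AE_space by eventually_elim (use assms(4) in \<open>blast intro: order_trans ennreal_leI\<close>)
  then show ?thesis using 1 Lnorm_top_le_iff[OF assms(1)] by simp
next
  case (2 S)
  then show ?thesis
    by (auto simp: Lnorm_ennreal intro!: enn_powr_mono nn_integral_mono ennreal_leI powr_mono2 assms(4))
qed

section \<open>Balls in a space of homogeneous type\<close>

context homogeneous_type_space
begin

abbreviation B :: "'a \<Rightarrow> real \<Rightarrow> 'a set" where "B \<equiv> qball (space M) d"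

abbreviation qopen :: "'a set \<Rightarrow> bool" where "qopen \<equiv> openin (qtopology (space M) d)"

lemma B_subset_space: "B x r \<subseteq> space M"
  by (auto simp: qball_def)

lemma centre_in_B: "x \<in> space M \<Longrightarrow> 0 < r \<Longrightarrow> x \<in> B x r"
  using zero_iff[of x x] by (simp add: qball_def)

lemma B_mono: "r \<le> s \<Longrightarrow> B x r \<subseteq> B x s"
  by (auto simp: qball_def)

lemma B_sym: "x \<in> space M \<Longrightarrow> y \<in> space M \<Longrightarrow> y \<in> B x r \<longleftrightarrow> x \<in> B y r"
  by (auto simp: qball_def commute)

lemma qopen_sets: "qopen U \<Longrightarrow> U \<in> sets M"
  by (auto simp: sets_eq_borel)

lemma B_empty: "x \<in> space M \<Longrightarrow> r \<le> 0 \<Longrightarrow> B x r = {}"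
  using nonneg by (force simp: qball_def)

lemma qopen_B: "x \<in> space M \<Longrightarrow> qopen (B x r)"
  using openin_qball B_empty by (cases "0 < r") auto

lemma B_sets [measurable, simp]: "x \<in> space M \<Longrightarrow> B x r \<in> sets M"
  by (intro qopen_sets qopen_B)

lemma topspace_eq: "topspace (qtopology (space M) d) = space M"
proof
  show "topspace (qtopology (space M) d) \<subseteq> space M"
    using openin_topspace[of "qtopology (space M) d"] unfolding openin_qtopology by blast
  have "qopen (space M)"
    unfolding openin_qtopology using B_subset_space by (auto intro: exI[of _ 1])
  then show "space M \<subseteq> topspace (qtopology (space M) d)"
    by (rule openin_subset)
qed

lemma emeasure_B_finite: 
  assumes "x \<in> space M"
  shows "emeasure M (B x r) < \<infinity>"
proof (cases "0 < r")
  case True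
  obtain C :: real where C: "\<And>x r. x\<in>space M \<Longrightarrow> r>0 \<Longrightarrow>
      0 < emeasure M (B x (2 * r)) \<and>
        emeasure M (B x (2 * r)) \<le> ennreal C * emeasure M (B x r) \<and>
        ennreal C * emeasure M (B x r) < \<infinity>"
    using doubling by metis
  from C[OF assms, of "r/2"] True show ?thesis
    by (auto intro: le_less_trans)
qed (use assms B_empty in auto)

lemma emeasure_B_eq: "x \<in> space M \<Longrightarrow> emeasure M (B x r) = ennreal (measure M (B x r))"
  using emeasure_B_finite[of x r] by (intro emeasure_eq_ennreal_measure) auto

lemma measure_B_pos:
  assumes "x \<in> space M" "0 < r"
  shows "0 < measure M (B x r)"
proof -
  have "0 < emeasure M (B x (2 * (r / 2)))"
    using doubling assms by (metis half_gt_zero)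
  then show ?thesis using emeasure_B_eq[OF assms(1), of r] by simp
qed

lemma measure_B_mono:
  assumes "x \<in> space M" "A \<subseteq> B x r" "A \<in> sets M"
  shows "measure M A \<le> measure M (B x r)"
  using assms emeasure_B_finite[of x r] by (intro measure_mono_fmeasurable) (auto simp: fmeasurable_def)

text \<open>Iterating the doubling inequality handles an arbitrary dilation factor; real-valued measures
  are used because balls have finite measure.\<close>
lemma measure_B_dilate:
  "\<exists>D\<ge>1. \<forall>x\<in>space M. \<forall>r>0. measure M (B x (c * r)) \<le> D * measure M (B x r)"
proof -
  obtain C :: real where C: "\<And>x r. x\<in>space M \<Longrightarrow> r>0 \<Longrightarrow>
        emeasure M (B x (2 * r)) \<le> ennreal C * emeasure M (B x r)"
    using doubling by metis
  define D where "D = max 1 C"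
  have D: "measure M (B x (2 * r)) \<le> D * measure M (B x r)" if "x \<in> space M" "r > 0" for x r
  proof -
    have "ennreal (measure M (B x (2 * r))) \<le> ennreal C * ennreal (measure M (B x r))"
      using C[OF that] that by (simp add: emeasure_B_eq)
    also have "\<dots> \<le> ennreal D * ennreal (measure M (B x r))"
      by (intro mult_right_mono ennreal_leI) (auto simp: D_def)
    also have "\<dots> = ennreal (D * measure M (B x r))"
      by (simp add: D_def ennreal_mult)
    finally show ?thesis
      by (subst (asm) ennreal_le_iff) (auto simp: D_def)
  qed
  have D1: "D \<ge> 1" by (simp add: D_def)
  have pow: "measure M (B x (2 ^ k * r)) \<le> D ^ k * measure M (B x r)"
    if "x \<in> space M" "r > 0" for x r k
  proof (induction k)
    case (Suc k)
    have "measure M (B x (2 ^ Suc k * r)) \<le> D * measure M (B x (2 ^ k * r))"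
      using D[OF that(1), of "2 ^ k * r"] that by (simp add: mult.assoc)
    also have "\<dots> \<le> D * (D ^ k * measure M (B x r))"
      using Suc D1 by (intro mult_left_mono) auto
    finally show ?case by (simp add: mult.assoc)
  qed simp
  obtain k :: nat where k: "c < 2 ^ k"
    using real_arch_pow[of 2 c] by auto
  show ?thesis
  proof (intro exI[of _ "D ^ k"] conjI ballI allI impI)
    show "1 \<le> D ^ k" using D1 by simp
    fix x and r :: real assume x: "x \<in> space M" "0 < r"
    have "measure M (B x (c * r)) \<le> measure M (B x (2 ^ k * r))"
      using x k by (intro measure_B_mono B_mono) auto
    with pow[OF x, of k] show "measure M (B x (c * r)) \<le> D ^ k * measure M (B x r)" by linarith
  qed
qed

section \<open>Outer regularity of the measure\<close>

text \<open>The erosions of an open set exhaust it as the radius tends to \<open>0\<close>, and they are closed. They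
  replace the distance function to the complement, which need not be continuous for a quasi-metric.\<close>
definition erosion :: "real \<Rightarrow> 'a set \<Rightarrow> 'a set" where
  "erosion r U = {y \<in> space M. B y r \<subseteq> U}"

text \<open>By symmetry of \<open>d\<close>, a point leaves the erosion exactly when it lies in a ball around a point
  outside \<open>U\<close>, so the complement of the erosion is a union of balls, which are open.\<close>
lemma qopen_compl_erosion: "qopen (space M - erosion r U)"
proof -
  have "space M - erosion r U = (\<Union>z\<in>space M - U. B z r)"
  proof (intro equalityI subsetI)
    fix y assume "y \<in> space M - erosion r U"
    then obtain z where "y \<in> space M" "z \<in> B y r" "z \<notin> U" by (auto simp: erosion_def)
    then show "y \<in> (\<Union>z\<in>space M - U. B z r)"
      using B_sym B_subset_space by blast
  next
    fix y assume "y \<in> (\<Union>z\<in>space M - U. B z r)"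
    then show "y \<in> space M - erosion r U"
      using B_sym B_subset_space by (fastforce simp: erosion_def)
  qed
  also have "qopen \<dots>" by (intro openin_Union) (auto intro: qopen_B)
  finally show ?thesis .
qed

lemma closed_sets: "F \<subseteq> space M \<Longrightarrow> qopen (space M - F) \<Longrightarrow> F \<in> sets M"
  using sets.compl_sets[OF qopen_sets, of "space M - F"] by (simp add: double_diff)

lemma erosion_sets [measurable]: "erosion r U \<in> sets M"
  by (intro closed_sets qopen_compl_erosion) (auto simp: erosion_def)

lemma erosion_subset: "0 < r \<Longrightarrow> erosion r U \<subseteq> U"
  using centre_in_B by (auto simp: erosion_def)

lemma erosion_antimono: "r \<le> s \<Longrightarrow> erosion s U \<subseteq> erosion r U"
  using B_mono by (fastforce simp: erosion_def)

lemma emeasure_diff_erosion_tendsto_0: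
  assumes "qopen U" "E \<in> sets M" "emeasure M E < \<infinity>"
  shows "(\<lambda>n. emeasure M ((U - erosion (1 / Suc n) U) \<inter> E)) \<longlonglongrightarrow> 0"
proof -
  have "(\<Inter>n. (U - erosion (1 / Suc n) U) \<inter> E) = {}"
  proof -
    have "\<exists>n. x \<in> erosion (1 / Suc n) U" if x: "x \<in> U" for x
    proof -
      obtain r where r: "r > 0" "B x r \<subseteq> U" "x \<in> space M"
        using assms(1) x unfolding openin_qtopology by blast
      then obtain n where "inverse (real (Suc n)) < r" using reals_Archimedean by blast
      then have "B x (1 / Suc n) \<subseteq> U" using B_mono[of "1 / Suc n" r x] r
        by (auto simp: inverse_eq_divide)
      then show ?thesis using r by (auto simp: erosion_def)
    qed
    then show ?thesis by blast
  qed
  moreover have "(\<lambda>n. emeasure M ((U - erosion (1 / Suc n) U) \<inter> E)) \<longlonglongrightarrow>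
      emeasure M (\<Inter>n. (U - erosion (1 / Suc n) U) \<inter> E)"
  proof (rule Lim_emeasure_decseq)
    show "range (\<lambda>n. (U - erosion (1 / Suc n) U) \<inter> E) \<subseteq> sets M"
      using assms qopen_sets by auto
    have "erosion (1 / Suc m) U \<subseteq> erosion (1 / Suc n) U" if "m \<le> n" for m n
      using that by (intro erosion_antimono) (auto simp: frac_le)
    then show "decseq (\<lambda>n. (U - erosion (1 / Suc n) U) \<inter> E)"
      by (auto simp: decseq_def)
    show "emeasure M ((U - erosion (1 / Suc n) U) \<inter> E) \<noteq> \<infinity>" for n
      using assms emeasure_mono[of "(U - erosion (1 / Suc n) U) \<inter> E" E M] by auto
  qed
  ultimately show ?thesis by simp
qed

text \<open>The sets that can be squeezed between a closed and an open set, up to small measure inside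
  \<open>E\<close>, form a \<open>\<sigma>\<close>-algebra. It contains the open sets because their closed erosions increase to
  them. For a union, the closed sets \<open>F i\<close> have to be cut to finitely many, since an infinite union
  of closed sets need not be closed; finiteness of \<open>\<mu>(E)\<close> makes the loss small.\<close>
lemma regular_in_finite_set:
  assumes "A \<in> sets M" "E \<in> sets M" "emeasure M E < \<infinity>" "0 < (e::ennreal)"
  shows "\<exists>F U. F \<subseteq> A \<and> A \<subseteq> U \<and> qopen (space M - F) \<and> qopen U \<and> emeasure M ((U - F) \<inter> E) < e"
proof -
  have "\<forall>e>0. \<exists>F U. F \<subseteq> A \<and> A \<subseteq> U \<and> qopen (space M - F) \<and> qopen U \<and> emeasure M ((U - F) \<inter> E) < e"
    (is "\<forall>e>0. ?P A e")
    using assms(1) unfolding sets_eq_borel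
  proof (induction rule: sigma_sets.induct)
    case (Basic U)
    then have U: "qopen U" by simp
    show ?case
    proof (intro allI impI)
      fix e :: ennreal assume "0 < e"
      then have "\<forall>\<^sub>F n in sequentially. emeasure M ((U - erosion (1 / Suc n) U) \<inter> E) < e"
        using order_tendstoD(2)[OF emeasure_diff_erosion_tendsto_0[OF U assms(2,3)]] by blast
      then obtain n where "emeasure M ((U - erosion (1 / Suc n) U) \<inter> E) < e"
        by (auto simp: eventually_sequentially)
      then show "?P U e"
        using U erosion_subset[of "1 / Suc n" U] qopen_compl_erosion
        by (intro exI[of _ "erosion (1 / Suc n) U"] exI[of _ U]) auto
    qed
  next
    case Empty
    have "qopen (space M)" using openin_topspace topspace_eq by metis
    then show ?case by (intro allI impI exI[of _ "{}"]) auto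
  next
    case (Compl A)
    show ?case
    proof (intro allI impI)
      fix e :: ennreal assume "0 < e"
      from Compl.IH[rule_format, OF this] obtain F U where FU: "F \<subseteq> A" "A \<subseteq> U"
          "qopen (space M - F)" "qopen U" "emeasure M ((U - F) \<inter> E) < e"
        by (elim exE conjE)
      have "U \<subseteq> space M" using FU(4) by (simp add: openin_qtopology)
      then have "(space M - F) - (space M - U) = U - F" "space M - (space M - U) = U" by auto
      then show "?P (space M - A) e"
        using FU by (intro exI[of _ "space M - U"] exI[of _ "space M - F"]) auto
    qed
  next
    case (Union A)
    show ?case
    proof (intro allI impI)
      fix e :: ennreal assume "0 < e"
      then obtain e' where e': "0 < e'" "e' < e" using dense by blast
      then obtain c where c: "0 < c" "e' = ennreal c" by (cases e') auto
      have "\<exists>F U. F \<subseteq> A i \<and> A i \<subseteq> U \<and> qopen (space M - F) \<and> qopen U \<and>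
          emeasure M ((U - F) \<inter> E) < ennreal (c * (1 / 2) ^ Suc i)" for i
        using Union.IH[of i] c by simp
      then obtain F U where FU: "\<And>i. F i \<subseteq> A i" "\<And>i. A i \<subseteq> U i" "\<And>i. qopen (space M - F i)"
          "\<And>i. qopen (U i)" "\<And>i. emeasure M ((U i - F i) \<inter> E) < ennreal (c * (1 / 2) ^ Suc i)"
        by metis
      define V where "V = (\<Union>i. U i)"
      define G where "G n = (\<Union>i<n. F i)" for n
      have V: "qopen V" unfolding V_def using FU(4) by blast
      have US: "U i \<subseteq> space M" for i using FU(4)[of i] by (simp add: openin_qtopology)
      have FS: "F i \<in> sets M" for i 
        using FU(1)[of i] FU(2)[of i] US FU(3) by (intro closed_sets) auto
      have [measurable]: "V \<in> sets M" "G n \<in> sets M" "E \<in> sets M" "U i \<in> sets M" "F i \<in> sets M" for n i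
        using V FS assms(2) FU(4) by (auto simp: G_def intro: qopen_sets)
      have lim: "(\<lambda>n. emeasure M ((V - G n) \<inter> E)) \<longlonglongrightarrow> emeasure M (\<Inter>n. (V - G n) \<inter> E)"
      proof (rule Lim_emeasure_decseq)
        show "decseq (\<lambda>n. (V - G n) \<inter> E)" by (force simp: decseq_def G_def)
        show "emeasure M ((V - G n) \<inter> E) \<noteq> \<infinity>" for n
          using assms emeasure_mono[of "(V - G n) \<inter> E" E M] by auto
      qed auto
      have "(\<Inter>n. (V - G n) \<inter> E) \<subseteq> (\<Union>i. (U i - F i) \<inter> E)"
      proof
        fix x assume x: "x \<in> (\<Inter>n. (V - G n) \<inter> E)"
        then obtain i where "x \<in> U i" by (auto simp: V_def)
        moreover have "x \<notin> F i" using x by (force simp: G_def)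
        ultimately show "x \<in> (\<Union>i. (U i - F i) \<inter> E)" using x by auto
      qed
      then have "emeasure M (\<Inter>n. (V - G n) \<inter> E) \<le> emeasure M (\<Union>i. (U i - F i) \<inter> E)"
        by (intro emeasure_mono) auto
      also have "\<dots> \<le> (\<Sum>i. emeasure M ((U i - F i) \<inter> E))"
        by (intro emeasure_subadditive_countably) auto
      also have "\<dots> \<le> (\<Sum>i. ennreal (c * (1 / 2) ^ Suc i))"
        using FU(5) by (intro suminf_le) (auto intro: less_imp_le)
      also have "\<dots> = ennreal (c * 1)"
        using power_half_series[THEN sums_mult, of c] c
        by (intro suminf_ennreal_eq) auto
      finally have "emeasure M (\<Inter>n. (V - G n) \<inter> E) < e" using c e' by simp
      from order_tendstoD(2)[OF lim this] obtain n where n: "emeasure M ((V - G n) \<inter> E) < e"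
        by (auto simp: eventually_sequentially)
      have "qopen (space M - G n)"
      proof -
        have "qopen ((\<Inter>i<n. space M - F i) \<inter> topspace (qtopology (space M) d))"
          using FU(3) by (intro openin_INT) auto
        moreover have "(\<Inter>i<n. space M - F i) \<inter> space M = space M - G n"
          by (auto simp: G_def)
        ultimately show ?thesis by (simp add: topspace_eq)
      qed
      moreover have "G n \<subseteq> \<Union>(range A)" using FU(1) unfolding G_def by blast
      moreover have "\<Union>(range A) \<subseteq> V" using FU(2) unfolding V_def by blast
      ultimately show "?P (\<Union>(range A)) e"
        using V n by (intro exI[of _ "G n"] exI[of _ V] conjI) auto
    qed
  qed
  with assms(4) show ?thesis by simp
qed

lemma outer_regular_in_B:
  assumes "A \<in> sets M" "x \<in> space M" "A \<subseteq> B x R" "0 < (e::ennreal)"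
  shows "\<exists>U. qopen U \<and> A \<subseteq> U \<and> U \<subseteq> B x R \<and> emeasure M (U - A) < e"
proof -
  obtain F U where FU: "F \<subseteq> A" "A \<subseteq> U" "qopen (space M - F)" "qopen U" "emeasure M ((U - F) \<inter> B x R) < e"
    using regular_in_finite_set[OF assms(1) _ _ assms(4), of "B x R"] assms emeasure_B_finite by auto
  have "F \<in> sets M" using FU sets.sets_into_space[OF assms(1)] by (intro closed_sets) auto
  then have "emeasure M (U \<inter> B x R - A) \<le> emeasure M ((U - F) \<inter> B x R)"
    using FU assms qopen_sets by (intro emeasure_mono) auto
  then show ?thesis using FU assms qopen_B
    by (intro exI[of _ "U \<inter> B x R"]) auto
qed

end

section \<open>Density points\<close>

lemma emeasure_UN_le_nn_integral_count_space:
  assumes "countable I" and [measurable]: "\<And>i. i \<in> I \<Longrightarrow> X i \<in> sets M"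
  shows "emeasure M (\<Union>i\<in>I. X i) \<le> (\<integral>\<^sup>+i. emeasure M (X i) \<partial>count_space I)"
proof -
  have "(\<Union>i\<in>I. X i) \<in> sets M" using assms by (intro sets.countable_UN') auto
  then have "emeasure M (\<Union>i\<in>I. X i) = (\<integral>\<^sup>+x. indicator (\<Union>i\<in>I. X i) x \<partial>M)"
    by simp
  also have "\<dots> \<le> (\<integral>\<^sup>+x. \<integral>\<^sup>+i. indicator (X i) x \<partial>count_space I \<partial>M)"
  proof (intro nn_integral_mono)
    fix x
    show "indicator (\<Union>i\<in>I. X i) x \<le> (\<integral>\<^sup>+i. indicator (X i) x \<partial>count_space I :: ennreal)"
    proof (cases "x \<in> (\<Union>i\<in>I. X i)")
      case True
      then obtain i where "i \<in> I" "x \<in> X i" by blast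
      with nn_integral_ge_point[of i I "\<lambda>i. indicator (X i) x"] True show ?thesis by simp
    qed simp
  qed
  also have "\<dots> = (\<integral>\<^sup>+i. \<integral>\<^sup>+x. indicator (X i) x \<partial>M \<partial>count_space I)"
    by (intro nn_integral_count_space_nn_integral assms) auto
  also have "\<dots> = (\<integral>\<^sup>+i. emeasure M (X i) \<partial>count_space I)"
    by (intro nn_integral_cong) simp
  finally show ?thesis .
qed

context homogeneous_type_space
begin

text \<open>Each ball of the family contains its own point of a countable dense set.\<close>
lemma countable_disjoint_balls:
  assumes "Y \<subseteq> space M" "0 < r" "disjoint_family_on (\<lambda>y. B y r) Y"
  shows "countable Y"
proof -
  obtain S where S: "countable S" "\<And>T. qopen T \<Longrightarrow> T \<noteq> {} \<Longrightarrow> S \<inter> T \<noteq> {}"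
    using separable unfolding separable_space_def dense_intersects_open by metis
  have "\<exists>s. s \<in> S \<inter> B y r" if "y \<in> Y" for y
    using S(2)[of "B y r"] qopen_B centre_in_B[of y r] assms that by blast
  then obtain g where g: "\<And>y. y \<in> Y \<Longrightarrow> g y \<in> S \<inter> B y r" by metis
  have "inj_on g Y"
    using g assms(3) unfolding inj_on_def disjoint_family_on_def
    by (metis Int_iff empty_iff)
  moreover have "countable (g ` Y)" using g by (intro countable_subset[OF _ S(1)]) auto
  ultimately show ?thesis by (metis countable_image_inj_on)
qed

text \<open>Since all balls have the same radius, Zorn's lemma replaces the selection by decreasing radii
  that is customary in covering arguments of Vitali type.\<close>
lemma ex_maximal_disjoint_balls:
  assumes "D \<subseteq> space M" "0 < r"
  obtains Y where "Y \<subseteq> D" "disjoint_family_on (\<lambda>y. B y r) Y"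
    "\<And>z. z \<in> D \<Longrightarrow> \<exists>y\<in>Y. B y r \<inter> B z r \<noteq> {}"
proof -
  let ?F = "{Y. Y \<subseteq> D \<and> disjoint_family_on (\<lambda>y. B y r) Y}"
  have "\<exists>Y\<in>?F. \<forall>Z\<in>?F. Y \<subseteq> Z \<longrightarrow> Z = Y"
  proof (rule subset_Zorn_nonempty)
    show "?F \<noteq> {}" by (auto simp: disjoint_family_on_def intro!: exI[of _ "{}"])
    fix C assume C: "C \<noteq> {}" "subset.chain ?F C"
    have "disjoint_family_on (\<lambda>y. B y r) (\<Union>C)"
      unfolding disjoint_family_on_def
    proof (intro ballI impI)
      fix y z assume "y \<in> \<Union>C" "z \<in> \<Union>C" "y \<noteq> z"
      then obtain Y Z where "Y \<in> C" "y \<in> Y" "Z \<in> C" "z \<in> Z" by blast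
      with C(2) have "Y \<subseteq> Z \<or> Z \<subseteq> Y" "Y \<in> ?F" "Z \<in> ?F"
        unfolding subset_chain_def by blast+
      with \<open>y \<in> Y\<close> \<open>z \<in> Z\<close> \<open>y \<noteq> z\<close> show "B y r \<inter> B z r = {}"
        unfolding disjoint_family_on_def by blast
    qed
    with C show "\<Union>C \<in> ?F" unfolding subset_chain_def by blast
  qed
  then obtain Y where YF: "Y \<in> ?F" and max: "\<forall>Z\<in>?F. Y \<subseteq> Z \<longrightarrow> Z = Y" by (elim bexE)
  then have Y: "Y \<subseteq> D" "disjoint_family_on (\<lambda>y. B y r) Y" by simp_all
  have "\<exists>y\<in>Y. B y r \<inter> B z r \<noteq> {}" if "z \<in> D" for z
  proof (rule ccontr)
    assume *: "\<not> ?thesis"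
    then have "disjoint_family_on (\<lambda>y. B y r) (insert z Y)"
      using Y(2) unfolding disjoint_family_on_def by blast
    then have "insert z Y = Y" using Y(1) \<open>z \<in> D\<close> by (intro max[rule_format]) auto
    with * centre_in_B[of z r] assms \<open>z \<in> D\<close> show False by blast
  qed
  with Y(1,2) show ?thesis by (rule that)
qed

text \<open>A weak density theorem in measure rather than almost everywhere. The set \<open>N\<close> collects the
  points of an open set \<open>U \<supseteq> A\<close> that are too close to its complement, and the dilates of a maximal
  disjoint family of balls that lie in \<open>U\<close> but mostly miss \<open>A\<close>.\<close>
lemma eventually_half_density:
  assumes A [measurable]: "A \<in> sets M" and x: "x \<in> space M" and AB: "A \<subseteq> B x R" and e: "0 < (e::real)"
  shows "\<forall>\<^sub>F r in at_right 0. \<exists>N\<in>sets M. emeasure M N \<le> ennreal e \<and>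
      (\<forall>y\<in>A - N. measure M (B y r) \<le> 2 * measure M (A \<inter> B y r))"
proof -
  obtain k where k: "k \<ge> 1" "\<And>x y z. x \<in> space M \<Longrightarrow> y \<in> space M \<Longrightarrow> z \<in> space M \<Longrightarrow> d x y \<le> k * (d x z + d z y)"
    using quasi_triangle by blast
  obtain D where D: "D \<ge> 1" "\<And>x r. x \<in> space M \<Longrightarrow> r > 0 \<Longrightarrow> measure M (B x (2 * k * r)) \<le> D * measure M (B x r)"
    using measure_B_dilate[of "2 * k"] by metis
  obtain U where U: "qopen U" "A \<subseteq> U" "U \<subseteq> B x R" "emeasure M (U - A) < ennreal (e / (4 * D))"
    using outer_regular_in_B[OF A x AB, of "ennreal (e / (4 * D))"] e D by auto
  have [measurable]: "U \<in> sets M" using U(1) by (rule qopen_sets)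
  have "(\<lambda>n. emeasure M ((U - erosion (1 / Suc n) U) \<inter> B x R)) \<longlonglongrightarrow> 0"
    using emeasure_B_finite x by (intro emeasure_diff_erosion_tendsto_0 U) auto
  from order_tendstoD(2)[OF this, of "ennreal (e / 2)"] e
  obtain n where "emeasure M ((U - erosion (1 / Suc n) U) \<inter> B x R) < ennreal (e / 2)"
    by (auto simp: eventually_sequentially)
  moreover have "(U - erosion (1 / Suc n) U) \<inter> B x R = U - erosion (1 / Suc n) U" using U by blast
  ultimately have n: "emeasure M (U - erosion (1 / Suc n) U) < ennreal (e / 2)" by simp
  have "\<exists>N\<in>sets M. emeasure M N \<le> ennreal e \<and>
      (\<forall>y\<in>A - N. measure M (B y r) \<le> 2 * measure M (A \<inter> B y r))" if r: "0 < r" "r < 1 / Suc n" for r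
  proof -
    define E where "E = {y \<in> A \<inter> erosion r U. measure M (B y r) > 2 * measure M (A \<inter> B y r)}"
    have ES: "E \<subseteq> space M" using sets.sets_into_space[OF A] by (auto simp: E_def)
    obtain Y where Y: "Y \<subseteq> E" "disjoint_family_on (\<lambda>y. B y r) Y"
        "\<And>z. z \<in> E \<Longrightarrow> \<exists>y\<in>Y. B y r \<inter> B z r \<noteq> {}"
      using ex_maximal_disjoint_balls[OF ES r(1)] by blast
    have YS: "y \<in> space M" if "y \<in> Y" for y using that Y ES by blast
    have cY: "countable Y" using Y(2) YS r by (intro countable_disjoint_balls) auto
    define G where "G = (\<Union>y\<in>Y. B y (2 * k * r))"
    have [measurable]: "G \<in> sets M" unfolding G_def using cY YS by (intro sets.countable_UN') auto
    have EG: "E \<subseteq> G"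
    proof
      fix z assume z: "z \<in> E"
      then obtain y w where y: "y \<in> Y" "w \<in> B y r" "w \<in> B z r" using Y(3) by blast
      then have "d y z \<le> k * (d y w + d w z)" using YS ES z B_subset_space by (intro k) blast+
      also have "d w z = d z w" using y z ES B_subset_space by (intro commute) blast+
      also have "k * (d y w + d z w) < k * (r + r)"
        using y k(1) by (intro mult_strict_left_mono add_strict_mono) (auto simp: qball_def)
      also have "k * (r + r) = 2 * k * r" by simp
      finally show "z \<in> G" using y z ES by (auto simp: G_def qball_def)
    qed
    \<comment> \<open>A failing ball has at least half of its mass outside \<open>A\<close>; this is what doubling transfers to its dilate.\<close>
    have bad: "emeasure M (B y (2 * k * r)) \<le> ennreal (2 * D) * emeasure M (B y r - A)" if "y \<in> Y" for y
    proof -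
      have y: "y \<in> space M" "y \<in> E" using YS that Y by auto
      have fin: "emeasure M (B y r - A) \<noteq> \<infinity>"
        using emeasure_mono[of "B y r - A" "B y r" M] emeasure_B_finite[of y r] y by auto
      have finI: "emeasure M (A \<inter> B y r) \<noteq> \<infinity>"
        using emeasure_mono[of "A \<inter> B y r" "B y r" M] emeasure_B_finite[of y r] y by auto
      have "(A \<inter> B y r) \<union> (B y r - A) = B y r" by blast
      then have "measure M (B y r) = measure M (A \<inter> B y r) + measure M (B y r - A)"
        using measure_Union[OF finI fin] y by auto
      with y(2) have "measure M (B y r) \<le> 2 * measure M (B y r - A)" by (auto simp: E_def)
      then have "D * measure M (B y r) \<le> D * (2 * measure M (B y r - A))" using D by (intro mult_left_mono) auto
      then have "measure M (B y (2 * k * r)) \<le> (2 * D) * measure M (B y r - A)"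
        using D(2)[OF y(1) r(1)] by simp
      moreover have "emeasure M (B y r - A) = ennreal (measure M (B y r - A))"
        using fin by (intro emeasure_eq_ennreal_measure) auto
      ultimately show ?thesis using y D(1)
        by (simp add: emeasure_B_eq ennreal_mult[symmetric] ennreal_leI)
    qed
    have "emeasure M G \<le> (\<integral>\<^sup>+y. emeasure M (B y (2 * k * r)) \<partial>count_space Y)"
      unfolding G_def using cY YS by (intro emeasure_UN_le_nn_integral_count_space) auto
    also have "\<dots> \<le> (\<integral>\<^sup>+y. ennreal (2 * D) * emeasure M (B y r - A) \<partial>count_space Y)"
      using bad by (intro nn_integral_mono) auto
    also have "\<dots> = ennreal (2 * D) * (\<integral>\<^sup>+y. emeasure M (B y r - A) \<partial>count_space Y)"
      by (intro nn_integral_cmult) auto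
    also have "(\<integral>\<^sup>+y. emeasure M (B y r - A) \<partial>count_space Y) = emeasure M (\<Union>y\<in>Y. B y r - A)"
      using cY YS Y(2) by (intro emeasure_UN_countable[symmetric]) (auto simp: disjoint_family_on_def)
    also have "\<dots> \<le> emeasure M (U - A)"
      using Y(1) by (intro emeasure_mono) (auto simp: E_def erosion_def)
    also have "\<dots> \<le> ennreal (e / (4 * D))" using U by simp
    finally have "emeasure M G \<le> ennreal (2 * D) * ennreal (e / (4 * D))" by (simp add: mult_left_mono)
    also have "\<dots> = ennreal (e / 2)" using D e by (simp add: ennreal_mult[symmetric])
    finally have G: "emeasure M G \<le> ennreal (e / 2)" .
    let ?N = "(U - erosion (1 / Suc n) U) \<union> G"
    have "emeasure M ?N \<le> emeasure M (U - erosion (1 / Suc n) U) + emeasure M G"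
      by (intro emeasure_subadditive) auto
    also have "\<dots> \<le> ennreal (e / 2) + ennreal (e / 2)" using n G by (intro add_mono) auto
    also have "\<dots> = ennreal e" using e by (simp add: ennreal_plus[symmetric] del: ennreal_plus)
    finally have "emeasure M ?N \<le> ennreal e" .
    moreover have "measure M (B y r) \<le> 2 * measure M (A \<inter> B y r)" if y: "y \<in> A - ?N" for y
    proof -
      have "y \<in> erosion r U" using y U(2) r erosion_antimono[of r "1 / Suc n" U] by auto
      with y EG show ?thesis by (fastforce simp: E_def)
    qed
    ultimately show ?thesis by (intro bexI[of _ ?N]) auto
  qed
  then show ?thesis
    by (auto simp: eventually_at_right_field intro!: exI[of _ "1 / Suc n"])
qed

section \<open>Exhaustion by balls\<close>

lemma ex_B_nat: "x \<in> space M \<Longrightarrow> y \<in> space M \<Longrightarrow> \<exists>n::nat. y \<in> B x n"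
  using reals_Archimedean2 by (auto simp: qball_def)

lemma Lnorm_le_exhaust:
  assumes x: "x \<in> space M" and s: "1 \<le> s" and [measurable]: "f \<in> borel_measurable M"
    and le: "\<And>n::nat. Lnorm M s (\<lambda>y. f y * indicator (B x n) y) \<le> K"
  shows "Lnorm M s f \<le> K"
  using s
proof (cases rule: exponent_cases)
  case 1
  have "AE y in M. \<forall>n::nat. ennreal (norm (f y * indicator (B x n) y)) \<le> K"
    unfolding AE_all_countable using le 1 x by (intro allI Lnorm_top_le_iff[THEN iffD1]) auto
  then have "AE y in M. ennreal (norm (f y)) \<le> K"
    using AE_space
  proof eventually_elim
    case (elim y)
    then obtain n0 :: nat where "y \<in> B x n0" using ex_B_nat[OF x] by blast
    with elim(1)[rule_format, of n0] show ?case by simp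
  qed
  then show ?thesis unfolding 1 by (intro Lnorm_top_le_iff[THEN iffD2]) simp_all
next
  case (2 S)
  let ?F = "\<lambda>n y. ennreal (norm (f y * indicator (B x (real n)) y) powr S)"
  have sup: "(SUP n. ?F n y) = ennreal (norm (f y) powr S)" if y: "y \<in> space M" for y
  proof (rule antisym)
    show "(SUP n. ?F n y) \<le> ennreal (norm (f y) powr S)"
      using 2 by (auto intro!: SUP_least split: split_indicator)
    obtain n0 :: nat where "y \<in> B x (real n0)" using ex_B_nat[OF x y] by blast
    then have "ennreal (norm (f y) powr S) = ?F n0 y" by simp
    also have "\<dots> \<le> (SUP n. ?F n y)" by (rule SUP_upper) simp
    finally show "ennreal (norm (f y) powr S) \<le> (SUP n. ?F n y)" .
  qed
  have "incseq ?F"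
  proof (intro incseq_SucI le_funI)
    fix n y
    have "B x (real n) \<subseteq> B x (real (Suc n))" by (intro B_mono) simp
    then show "?F n y \<le> ?F (Suc n) y"
      using 2 by (auto split: split_indicator)
  qed
  then have "(\<integral>\<^sup>+y. (SUP n. ?F n y) \<partial>M) = (SUP n. \<integral>\<^sup>+y. ?F n y \<partial>M)"
    using x by (intro nn_integral_monotone_convergence_SUP) auto
  also have "\<dots> \<le> enn_powr K S"
    using le 2 by (intro SUP_least) (simp add: Lnorm_le_iff)
  finally have "(\<integral>\<^sup>+y. ennreal (norm (f y) powr S) \<partial>M) \<le> enn_powr K S"
    by (simp add: sup cong: nn_integral_cong)
  then show ?thesis using 2 by (simp add: Lnorm_le_iff)
qed

lemma fmean_norm_at_le: "0 < r \<Longrightarrow> fmean_norm_at d M r q p \<alpha> f \<le> fmean_norm d M q p \<alpha> f"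
  unfolding fmean_norm_def by (intro SUP_upper) auto

lemma fmean_norm_at_top_ge:
  "y \<in> space M \<Longrightarrow>
    ennreal (measure M (B y r) powr (recip \<alpha> - recip q)) * Lnorm M q (\<lambda>x. f x * indicator (B y r) x)
      \<le> fmean_norm_at d M r q \<infinity> \<alpha> f"
  unfolding fmean_norm_at_def by (auto intro: SUP_upper2)

lemma fmean_norm_at_ennreal:
  "0 < P \<Longrightarrow> fmean_norm_at d M r q (ennreal P) \<alpha> f =
    enn_powr (\<integral>\<^sup>+y. enn_powr (ennreal (measure M (B y r) powr (recip \<alpha> - 1 / P - recip q)) *
             Lnorm M q (\<lambda>x. f x * indicator (B y r) x)) P \<partial>M) (1 / P)"
  by (simp add: fmean_norm_at_def recip_ennreal)

section \<open>The case of equal inner and middle exponents\<close>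

text \<open>For \<open>r = 2\<kappa>R\<close> and \<open>y\<close> in \<open>B(x,R)\<close> one has \<open>B(x,R) \<subseteq> B(y,r) \<subseteq> B(x,\<kappa>(R + r))\<close>, so the integrand
  of the norm with radius \<open>r\<close> is bounded below by a constant on \<open>B(x,R)\<close>. For \<open>p = \<infinity>\<close> the single
  ball \<open>B(x,R)\<close> already occurs in the supremum, with weight \<open>1\<close>.\<close>
lemma Lnorm_B_le_fmean_norm_same:
  assumes x: "x \<in> space M" and q: "1 \<le> q" and p: "1 \<le> p"
  shows "\<exists>C>0. \<forall>f\<in>borel_measurable M. \<forall>R>0.
      Lnorm M q (\<lambda>y. f y * indicator (B x R) y) \<le> ennreal C * fmean_norm d M q p q f"
  using p
proof (cases rule: exponent_cases)
  case 1
  show ?thesis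
  proof (intro exI[of _ 1] conjI ballI allI impI)
    fix f :: "'a \<Rightarrow> complex" and R :: real assume R: "0 < R"
    have "Lnorm M q (\<lambda>y. f y * indicator (B x R) y) \<le> fmean_norm_at d M R q \<infinity> q f"
      using fmean_norm_at_top_ge[OF x, of R q q f] measure_B_pos[OF x R] by simp
    also have "\<dots> \<le> fmean_norm d M q p q f"
      unfolding 1 by (rule fmean_norm_at_le[OF R])
    finally show "Lnorm M q (\<lambda>y. f y * indicator (B x R) y) \<le> ennreal 1 * fmean_norm d M q p q f"
      by simp
  qed simp
next
  case (2 P)
  obtain k where k: "k \<ge> 1" "\<And>x y z. x \<in> space M \<Longrightarrow> y \<in> space M \<Longrightarrow> z \<in> space M \<Longrightarrow> d x y \<le> k * (d x z + d z y)"
    using quasi_triangle by blast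
  define c where "c = k * (2 * k + 1)"
  obtain D where D: "D \<ge> 1" "\<And>x r. x \<in> space M \<Longrightarrow> r > 0 \<Longrightarrow> measure M (B x (c * r)) \<le> D * measure M (B x r)"
    using measure_B_dilate[of c] by metis
  have "Lnorm M q (\<lambda>y. f y * indicator (B x R) y) \<le> ennreal (D powr (1 / P)) * fmean_norm d M q p q f"
    if [measurable]: "f \<in> borel_measurable M" and R: "0 < R" for f R
  proof -
    define r where "r = 2 * k * R"
    have r: "0 < r" using k R by (simp add: r_def)
    define m where "m = measure M (B x R)"
    have m: "0 < m" using measure_B_pos[OF x R] by (simp add: m_def)
    define L where "L = Lnorm M q (\<lambda>y. f y * indicator (B x R) y)"
    have big: "B x R \<subseteq> B y r" "measure M (B y r) \<le> D * m" if y: "y \<in> B x R" for y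
    proof -
      have yS: "y \<in> space M" using y B_subset_space by blast
      have xy: "d x y < R" using y by (simp add: qball_def)
      show "B x R \<subseteq> B y r"
      proof
        fix z assume z: "z \<in> B x R"
        then have "d y z \<le> k * (d y x + d x z)" using k x yS B_subset_space by blast
        also have "\<dots> < k * (R + R)"
          using z xy k(1) commute[OF x yS] by (intro mult_strict_left_mono add_strict_mono) (auto simp: qball_def)
        finally show "z \<in> B y r" using z by (simp add: r_def qball_def)
      qed
      have "B y r \<subseteq> B x (c * R)"
      proof
        fix z assume z: "z \<in> B y r"
        then have "d x z \<le> k * (d x y + d y z)" using k x yS B_subset_space by blast
        also have "\<dots> < k * (R + r)"
          using z xy k(1) by (intro mult_strict_left_mono add_strict_mono) (auto simp: qball_def)
        finally show "z \<in> B x (c * R)" using z by (simp add: r_def c_def qball_def algebra_simps)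
      qed
      then have "measure M (B y r) \<le> measure M (B x (c * R))"
        using x yS by (intro measure_B_mono) auto
      also have "\<dots> \<le> D * m" unfolding m_def by (rule D(2)[OF x R])
      finally show "measure M (B y r) \<le> D * m" .
    qed
    let ?a = "ennreal ((D * m) powr (- (1 / P))) * L"
    let ?b = "\<lambda>y. ennreal (measure M (B y r) powr (recip q - 1 / P - recip q)) * Lnorm M q (\<lambda>x. f x * indicator (B y r) x)"
    have ab: "enn_powr ?a P * indicator (B x R) y \<le> enn_powr (?b y) P" for y
    proof (cases "y \<in> B x R")
      case True
      then have yS: "y \<in> space M" using B_subset_space by blast
      have "L \<le> Lnorm M q (\<lambda>x. f x * indicator (B y r) x)"
        unfolding L_def using x yS q big(1)[OF True] 
        by (intro Lnorm_mono) (auto split: split_indicator)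
      moreover have "(D * m) powr (- (1 / P)) \<le> measure M (B y r) powr (- (1 / P))"
        using big(2)[OF True] measure_B_pos[OF yS r] 2 by (intro powr_mono2') auto
      ultimately have "?a \<le> ?b y" by (auto intro!: mult_mono ennreal_leI)
      with True 2 show ?thesis by (auto intro: enn_powr_mono)
    qed simp
    have "enn_powr ?a P * ennreal m = (\<integral>\<^sup>+y. enn_powr ?a P * indicator (B x R) y \<partial>M)"
      using x by (simp add: nn_integral_cmult_indicator emeasure_B_eq m_def)
    also have "\<dots> \<le> (\<integral>\<^sup>+y. enn_powr (?b y) P \<partial>M)"
      using ab by (intro nn_integral_mono)
    finally have "enn_powr (enn_powr ?a P * ennreal m) (1 / P) \<le> fmean_norm_at d M r q p q f"
      using 2 by (auto simp: fmean_norm_at_ennreal intro!: enn_powr_mono)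
    also have "\<dots> \<le> fmean_norm d M q p q f" by (rule fmean_norm_at_le[OF r])
    also have "enn_powr (enn_powr ?a P * ennreal m) (1 / P) = ?a * ennreal (m powr (1 / P))"
      unfolding enn_powr_mult[of "enn_powr ?a P"] enn_powr_powr using 2 m by (simp add: enn_powr_ennreal)
    finally have le: "?a * ennreal (m powr (1 / P)) \<le> fmean_norm d M q p q f" .
    have "D powr (1 / P) * ((D * m) powr (- (1 / P)) * m powr (1 / P)) = 1"
      using D(1) m by (simp add: powr_mult powr_minus field_simps)
    then have "L = ennreal (D powr (1 / P) * ((D * m) powr (- (1 / P)) * m powr (1 / P))) * L"
      by simp
    also have "\<dots> = ennreal (D powr (1 / P)) * (?a * ennreal (m powr (1 / P)))"
      by (simp add: ennreal_mult mult_ac)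
    also have "\<dots> \<le> ennreal (D powr (1 / P)) * fmean_norm d M q p q f"
      by (intro mult_left_mono le) auto
    finally show ?thesis by (simp add: L_def)
  qed
  moreover have "D powr (1 / P) > 0" using D(1) by simp
  ultimately show ?thesis by blast
qed

section \<open>The case of equal middle and outer exponents\<close>

text \<open>The set \<open>E\<close> fills half of the ball, so the \<open>L\<^sup>q\<close> mean is at least \<open>t (1/2)\<^sup>1\<^sup>/\<^sup>q\<close>, and
  \<open>(1/2)\<^sup>1\<^sup>/\<^sup>q \<ge> 1/2\<close> since \<open>q \<ge> 1\<close>.\<close>
lemma half_le_mean:
  assumes y: "y \<in> space M" and r: "0 < r" and Q: "1 \<le> Q" and t: "0 \<le> t"
    and [measurable]: "f \<in> borel_measurable M" "E \<in> sets M"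
    and E: "\<And>x. x \<in> E \<Longrightarrow> t \<le> norm (f x)"
    and dens: "measure M (B y r) \<le> 2 * measure M (E \<inter> B y r)"
  shows "ennreal (t / 2) \<le> ennreal (measure M (B y r) powr (- (1 / Q))) *
      Lnorm M (ennreal Q) (\<lambda>x. f x * indicator (B y r) x)"
proof -
  define m where "m = measure M (B y r)"
  have m: "0 < m" using measure_B_pos[OF y r] by (simp add: m_def)
  have [measurable]: "B y r \<in> sets M" using y by simp
  have fin: "emeasure M (E \<inter> B y r) \<noteq> \<infinity>"
    using emeasure_mono[of "E \<inter> B y r" "B y r" M] emeasure_B_finite[of y r] y by auto
  have "ennreal (t powr Q * (m / 2)) \<le> ennreal (t powr Q * measure M (E \<inter> B y r))"
    using dens by (intro ennreal_leI mult_left_mono) (auto simp: m_def)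
  also have "\<dots> = (\<integral>\<^sup>+x. ennreal (t powr Q) * indicator (E \<inter> B y r) x \<partial>M)"
    using fin by (simp add: nn_integral_cmult_indicator ennreal_mult emeasure_eq_ennreal_measure)
  also have "\<dots> \<le> (\<integral>\<^sup>+x. ennreal (norm (f x * indicator (B y r) x) powr Q) \<partial>M)"
    using Q t by (intro nn_integral_mono)
      (auto split: split_indicator intro!: ennreal_leI powr_mono2 E)
  finally have "enn_powr (ennreal (t powr Q * (m / 2))) (1 / Q)
      \<le> Lnorm M (ennreal Q) (\<lambda>x. f x * indicator (B y r) x)"
    using Q by (auto simp: Lnorm_ennreal intro!: enn_powr_mono)
  note le = this
  have le: "ennreal (t * (m / 2) powr (1 / Q)) \<le> Lnorm M (ennreal Q) (\<lambda>x. f x * indicator (B y r) x)"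
  proof -
    have "(t powr Q * (m / 2)) powr (1 / Q) = (t powr Q) powr (1 / Q) * (m / 2) powr (1 / Q)"
      by (rule powr_mult)
    also have "(t powr Q) powr (1 / Q) = t" using Q t by (simp add: powr_powr)
    finally have "enn_powr (ennreal (t powr Q * (m / 2))) (1 / Q) = ennreal (t * (m / 2) powr (1 / Q))"
      using m by (subst enn_powr_ennreal) simp_all
    with le show ?thesis by simp
  qed
  have "(1 / 2) powr 1 \<le> (1 / 2 :: real) powr (1 / Q)"
    using Q by (intro powr_mono') auto
  then have "t / 2 \<le> t * (1 / 2) powr (1 / Q)"
    using mult_left_mono[OF _ t, of "1 / 2" "(1 / 2) powr (1 / Q)"] by simp
  also have "\<dots> = m powr (- (1 / Q)) * (t * (m / 2) powr (1 / Q))"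
    using m powr_mult[of "1 / 2" m "1 / Q"] by (simp add: powr_minus field_simps)
  finally have "ennreal (t / 2) \<le> ennreal (m powr (- (1 / Q))) * ennreal (t * (m / 2) powr (1 / Q))"
    using t by (simp add: ennreal_mult[symmetric] ennreal_leI)
  also have "\<dots> \<le> ennreal (m powr (- (1 / Q))) * Lnorm M (ennreal Q) (\<lambda>x. f x * indicator (B y r) x)"
    by (intro mult_left_mono le) auto
  finally show ?thesis by (simp add: m_def)
qed

text \<open>A level set at height \<open>t\<close> of positive measure contains a point of half density for some small
  radius, and there the mean is at least \<open>t / 2\<close>.\<close>
lemma Lnorm_B_le_fmean_norm_top:
  assumes x: "x \<in> space M" and Q: "1 \<le> Q" and [measurable]: "f \<in> borel_measurable M"
  shows "Lnorm M \<infinity> (\<lambda>y. f y * indicator (B x R) y) \<le> ennreal 2 * fmean_norm d M (ennreal Q) \<infinity> \<infinity> f"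
proof (cases "fmean_norm d M (ennreal Q) \<infinity> \<infinity> f = top")
  case True
  then show ?thesis by (simp add: ennreal_mult_top)
next
  case False
  then obtain k where k: "0 \<le> k" "fmean_norm d M (ennreal Q) \<infinity> \<infinity> f = ennreal k"
    by (cases "fmean_norm d M (ennreal Q) \<infinity> \<infinity> f") auto
  have [measurable]: "B x R \<in> sets M" using x by simp
  have null: "AE y in M. \<not> (y \<in> B x R \<and> t \<le> norm (f y))" if t: "2 * k < t" for t
  proof (rule ccontr)
    define E where "E = {y \<in> space M. y \<in> B x R \<and> t \<le> norm (f y)}"
    have E [measurable]: "E \<in> sets M" unfolding E_def by measurable
    assume "\<not> ?thesis"
    then have "emeasure M E \<noteq> 0"
      by (subst (asm) AE_iff_measurable[OF E]) (auto simp: E_def)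
    moreover have "emeasure M E < \<infinity>"
      by (rule le_less_trans[OF emeasure_mono emeasure_B_finite[OF x, of R]]) (auto simp: E_def)
    ultimately obtain e where e: "0 < e" "emeasure M E = ennreal e"
      by (cases "emeasure M E") (auto simp: less_le)
    have "\<forall>\<^sub>F r in at_right 0. \<exists>N\<in>sets M. emeasure M N \<le> ennreal (e / 2) \<and>
      (\<forall>y\<in>E - N. measure M (B y r) \<le> 2 * measure M (E \<inter> B y r))"
      using e by (intro eventually_half_density[OF E x, of R]) (auto simp: E_def)
    then have "\<forall>\<^sub>F r in at_right 0. 0 < r \<and> (\<exists>N\<in>sets M. emeasure M N \<le> ennreal (e / 2) \<and>
      (\<forall>y\<in>E - N. measure M (B y r) \<le> 2 * measure M (E \<inter> B y r)))"
      by (intro eventually_conj eventually_at_right_less)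
    from eventually_happens'[OF _ this] obtain r N where r: "0 < (r::real)" and
      N: "N \<in> sets M" "emeasure M N \<le> ennreal (e / 2)"
        "\<And>y. y \<in> E - N \<Longrightarrow> measure M (B y r) \<le> 2 * measure M (E \<inter> B y r)"
      by (auto simp: trivial_limit_at_right_real)
    have "\<not> E \<subseteq> N"
    proof
      assume "E \<subseteq> N"
      then have "ennreal e \<le> ennreal (e / 2)"
        using order_trans[OF emeasure_mono[of E N M] N(2)] N(1) e by simp
      with e show False by (simp add: ennreal_le_iff)
    qed
    then obtain y where y: "y \<in> E - N" by blast
    then have yS: "y \<in> space M" by (simp add: E_def)
    have "ennreal (t / 2) \<le> ennreal (measure M (B y r) powr (- (1 / Q))) *
      Lnorm M (ennreal Q) (\<lambda>x. f x * indicator (B y r) x)"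
      using t k by (intro half_le_mean[OF yS r Q _ _ E _ N(3)[OF y]]) (auto simp: E_def)
    also have "\<dots> \<le> fmean_norm_at d M r (ennreal Q) \<infinity> \<infinity> f"
      using fmean_norm_at_top_ge[OF yS, of r \<infinity> "ennreal Q" f] Q by (simp add: recip_ennreal)
    also have "\<dots> \<le> ennreal k"
      using fmean_norm_at_le[OF r, of "ennreal Q" \<infinity> \<infinity> f] k by simp
    finally show False using t k by (simp add: ennreal_le_iff)
  qed
  have "AE y in M. \<forall>n. \<not> (y \<in> B x R \<and> 2 * k + 1 / Suc n \<le> norm (f y))"
    unfolding AE_all_countable by (intro allI null) auto
  then have "AE y in M. ennreal (norm (f y * indicator (B x R) y)) \<le> ennreal (2 * k)"
  proof eventually_elim
    case (elim y)
    show ?case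
    proof (cases "y \<in> B x R")
      case True
      have "norm (f y) \<le> 2 * k"
      proof (rule ccontr)
        assume "\<not> ?thesis"
        then obtain n where "inverse (real (Suc n)) < norm (f y) - 2 * k"
          using reals_Archimedean[of "norm (f y) - 2 * k"] by auto
        with elim True show False by (auto simp: inverse_eq_divide dest!: spec[of _ n])
      qed
      with True show ?thesis by (simp add: ennreal_leI)
    qed simp
  qed
  then show ?thesis
    using k by (subst Lnorm_top_le_iff) (auto simp: ennreal_mult)
qed

text \<open>A simple function \<open>u\<close> below \<open>\<bar>f\<bar>\<^sup>p \<chi>\<^sub>W\<close> has finitely many level sets, so one radius \<open>r\<close> and one
  exceptional set \<open>N\<close> of small measure serve them all. Outside \<open>N\<close> the \<open>p\<close>-th power of the mean is at
  least \<open>2\<^sup>-\<^sup>p u\<close>, and the part of \<open>u\<close> over \<open>N\<close> is negligible because \<open>u\<close> is bounded.\<close>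
lemma Lnorm_B_le_fmean_norm_finite:
  assumes x: "x \<in> space M" and Q: "1 \<le> Q" and P: "1 \<le> P" and [measurable]: "f \<in> borel_measurable M"
  shows "Lnorm M (ennreal P) (\<lambda>y. f y * indicator (B x R) y)
      \<le> ennreal 2 * fmean_norm d M (ennreal Q) (ennreal P) (ennreal P) f"
proof -
  define K where "K = fmean_norm d M (ennreal Q) (ennreal P) (ennreal P) f"
  define W where "W = B x R"
  have W [measurable]: "W \<in> sets M" using x by (simp add: W_def)
  let ?h = "\<lambda>y. ennreal (norm (f y * indicator W y) powr P)"
  let ?b = "\<lambda>r y. ennreal (measure M (B y r) powr (- (1 / Q))) * Lnorm M (ennreal Q) (\<lambda>x. f x * indicator (B y r) x)"
  have mean: "(\<integral>\<^sup>+y. enn_powr (?b r y) P \<partial>M) \<le> enn_powr K P" if r: "0 < r" for r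
  proof -
    have "enn_powr (\<integral>\<^sup>+y. enn_powr (?b r y) P \<partial>M) (1 / P) \<le> K"
      using fmean_norm_at_le[OF r, of "ennreal Q" "ennreal P" "ennreal P" f] P Q
      by (simp add: fmean_norm_at_ennreal recip_ennreal K_def)
    then show ?thesis using P by (simp add: enn_powr_inverse_le_iff)
  qed
  have "(\<integral>\<^sup>+y. ?h y \<partial>M) \<le> enn_powr (ennreal 2 * K) P"
    unfolding nn_integral_def_finite[of M ?h]
  proof (rule SUP_least)
    fix u assume "u \<in> {g. simple_function M g \<and> g \<le> ?h \<and> (\<forall>x. g x < top)}"
    then have u: "simple_function M u" "\<And>y. u y \<le> ?h y" "\<And>y. u y < top"
      by (auto simp: le_fun_def)
    have [measurable]: "u \<in> borel_measurable M" using u(1) by (rule borel_measurable_simple_function)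
    have fin: "finite (u ` space M)" using u(1) by (rule simple_functionD)
    define c where "c = (\<Sum>v\<in>u ` space M. enn2real v)"
    have c0: "0 \<le> c" by (auto simp: c_def intro: sum_nonneg)
    have c: "u y \<le> ennreal c" if "y \<in> space M" for y
    proof -
      have "enn2real (u y) \<le> c" unfolding c_def using fin that by (intro member_le_sum) auto
      then have "ennreal (enn2real (u y)) \<le> ennreal c" by (rule ennreal_leI)
      then show ?thesis using u(3)[of y] by simp
    qed
    have "integral\<^sup>S M u = (\<integral>\<^sup>+y. u y \<partial>M)" using u(1) by (rule nn_integral_eq_simple_integral[symmetric])
    also have "\<dots> \<le> enn_powr (ennreal 2 * K) P"
    proof (rule ennreal_le_epsilon)
      fix e :: real assume e: "0 < e"
      \<comment> \<open>At most \<open>card (u ` space M)\<close> exceptional sets of measure \<open>e'\<close>, on which \<open>u \<le> c\<close>, contribute at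
        most \<open>e\<close>; adding \<open>1\<close> keeps both denominators positive.\<close>
      define e' where "e' = e / (c + 1) / (card (u ` space M) + 1)"
      have e': "0 < e'" using e c0 by (simp add: e'_def)
      let ?E = "\<lambda>v. {y \<in> space M. u y = v} \<inter> W"
      have E [measurable]: "?E v \<in> sets M" for v by measurable
      let ?G = "\<lambda>r v N. N \<in> sets M \<and> emeasure M N \<le> ennreal e' \<and>
          (\<forall>y\<in>?E v - N. measure M (B y r) \<le> 2 * measure M (?E v \<inter> B y r))"
      have "\<forall>\<^sub>F r in at_right 0. \<exists>N. ?G r v N" for v
        using eventually_half_density[OF E[of v] x _ e', of R] unfolding Bex_def by (simp add: W_def)
      then have "\<forall>\<^sub>F r in at_right 0. 0 < r \<and> (\<forall>v\<in>u ` space M. \<exists>N. ?G r v N)"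
        by (intro eventually_conj eventually_at_right_less eventually_ball_finite fin ballI)
      from eventually_happens'[OF trivial_limit_at_right_real this]
      obtain r where r: "0 < r" and "\<forall>v\<in>u ` space M. \<exists>N. ?G r v N" by (elim exE conjE)
      from bchoice[OF this(2)] obtain N' where N'G: "\<forall>v\<in>u ` space M. ?G r v (N' v)" by (elim exE)
      have N': "N' v \<in> sets M" "emeasure M (N' v) \<le> ennreal e'"
          "\<And>y. y \<in> ?E v - N' v \<Longrightarrow> measure M (B y r) \<le> 2 * measure M (?E v \<inter> B y r)"
        if "v \<in> u ` space M" for v
        using bspec[OF N'G that] by blast+
      define N where "N = (\<Union>v\<in>u ` space M. N' v)"
      have [measurable]: "N \<in> sets M" unfolding N_def using fin N'(1) by (intro sets.finite_UN) auto
      have "emeasure M N \<le> (\<Sum>v\<in>u ` space M. emeasure M (N' v))"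
        unfolding N_def using fin N'(1) by (intro emeasure_subadditive_finite) auto
      also have "\<dots> \<le> (\<Sum>v\<in>u ` space M. ennreal e')" using N'(2) by (intro sum_mono)
      also have "\<dots> = ennreal (card (u ` space M) * e')"
        using e' by (simp add: ennreal_of_nat_eq_real_of_nat ennreal_mult)
      finally have N: "emeasure M N \<le> ennreal (card (u ` space M) * e')" .
      have pt: "ennreal ((1 / 2) powr P) * u y * indicator (W - N) y \<le> enn_powr (?b r y) P" for y
      proof (cases "y \<in> W - N")
        case True
        define v where "v = u y"
        define t where "t = enn2real v powr (1 / P)"
        have yS: "y \<in> space M" using True B_subset_space by (auto simp: W_def)
        have v: "v \<in> u ` space M" "v = ennreal (enn2real v)" using yS u(3)[of y] by (auto simp: v_def)
        have tP: "t powr P = enn2real v" using P by (simp add: t_def powr_powr)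
        have "t \<le> norm (f z)" if z: "z \<in> ?E v" for z
        proof -
          have "ennreal (enn2real v) \<le> ennreal (norm (f z) powr P)"
            using u(2)[of z] z v(2) by simp
          then have "enn2real v \<le> norm (f z) powr P" by (simp add: ennreal_le_iff)
          then have "t \<le> (norm (f z) powr P) powr (1 / P)"
            unfolding t_def using P by (intro powr_mono2) auto
          then show ?thesis using P by (simp add: powr_powr)
        qed
        moreover have "measure M (B y r) \<le> 2 * measure M (?E v \<inter> B y r)"
          using True v yS by (intro N'(3)[OF v(1)]) (auto simp: v_def N_def)
        ultimately have "ennreal (t / 2) \<le> ?b r y"
          by (intro half_le_mean[OF yS r Q _ _ E]) (auto simp: t_def)
        then have "enn_powr (ennreal (t / 2)) P \<le> enn_powr (?b r y) P" using P by (intro enn_powr_mono) auto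
        moreover have "enn_powr (ennreal (t / 2)) P = ennreal ((1 / 2) powr P) * u y"
        proof -
          have "(t / 2) powr P = (1 / 2) powr P * enn2real v"
            using powr_mult[of "1 / 2" t P] tP by (simp add: t_def)
          then have "enn_powr (ennreal (t / 2)) P = ennreal ((1 / 2) powr P) * ennreal (enn2real v)"
            by (simp add: enn_powr_ennreal t_def ennreal_mult)
          then show ?thesis using v(2) by (simp add: v_def)
        qed
        ultimately show ?thesis using True by simp
      qed simp
      have "ennreal ((1 / 2) powr P) * (\<integral>\<^sup>+y. u y * indicator (W - N) y \<partial>M)
          = (\<integral>\<^sup>+y. ennreal ((1 / 2) powr P) * u y * indicator (W - N) y \<partial>M)"
        by (simp add: nn_integral_cmult mult.assoc)
      also have "\<dots> \<le> (\<integral>\<^sup>+y. enn_powr (?b r y) P \<partial>M)" using pt by (intro nn_integral_mono)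
      also have "\<dots> \<le> enn_powr K P" by (rule mean[OF r])
      finally have "ennreal (2 powr P) * (ennreal ((1 / 2) powr P) * (\<integral>\<^sup>+y. u y * indicator (W - N) y \<partial>M))
          \<le> ennreal (2 powr P) * enn_powr K P" by (intro mult_left_mono) auto
      moreover have "ennreal (2 powr P) * ennreal ((1 / 2) powr P) = 1"
        by (simp add: ennreal_mult[symmetric] powr_mult[symmetric])
      ultimately have I1: "(\<integral>\<^sup>+y. u y * indicator (W - N) y \<partial>M) \<le> enn_powr (ennreal 2 * K) P"
        unfolding enn_powr_mult by (simp add: enn_powr_ennreal mult.assoc[symmetric] del: ennreal_numeral)
      have uW: "u y = 0" if "y \<notin> W" for y using u(2)[of y] that P by simp
      have "(\<integral>\<^sup>+y. u y \<partial>M) \<le> (\<integral>\<^sup>+y. u y * indicator (W - N) y + ennreal c * indicator N y \<partial>M)"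
        by (intro nn_integral_mono) (auto split: split_indicator simp: uW intro: c)
      also have "\<dots> = (\<integral>\<^sup>+y. u y * indicator (W - N) y \<partial>M) + ennreal c * emeasure M N"
        by (simp add: nn_integral_add nn_integral_cmult_indicator)
      also have "\<dots> \<le> enn_powr (ennreal 2 * K) P + ennreal e"
      proof (intro add_mono I1)
        have "ennreal c * emeasure M N \<le> ennreal c * ennreal (card (u ` space M) * e')"
          by (intro mult_left_mono N) auto
        also have "\<dots> = ennreal (c * (card (u ` space M) * e'))" using c0 e' by (simp add: ennreal_mult)
        also have "\<dots> \<le> ennreal e"
        proof (rule ennreal_leI)
          have "c * (card (u ` space M) * e') = e * ((c / (c + 1)) * (card (u ` space M) / (card (u ` space M) + 1)))"
            by (simp add: e'_def)
          also have "\<dots> \<le> e * (1 * 1)" using c0 e by (intro mult_left_mono mult_mono) auto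
          finally show "c * (card (u ` space M) * e') \<le> e" by simp
        qed
        finally show "ennreal c * emeasure M N \<le> ennreal e" .
      qed
      finally show "(\<integral>\<^sup>+y. u y \<partial>M) \<le> enn_powr (ennreal 2 * K) P + ennreal e" .
    qed
    finally show "integral\<^sup>S M u \<le> enn_powr (ennreal 2 * K) P" .
  qed
  then show ?thesis using P by (simp add: Lnorm_le_iff K_def W_def)
qed

section \<open>The estimate\<close>

lemma Lnorm_le_fmean_norm:
  assumes q: "1 \<le> q" "q \<le> \<alpha>" "\<alpha> \<le> p" and eq: "q = \<alpha> \<or> \<alpha> = p"
  shows "\<exists>C>0. \<forall>f\<in>borel_measurable M. Lnorm M \<alpha> f \<le> ennreal C * fmean_norm d M q p \<alpha> f"
proof -
  have \<alpha>: "1 \<le> \<alpha>" and p: "1 \<le> p" using q by auto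
  have "space M \<noteq> {}" using infinite_measure by auto
  then obtain x where x: "x \<in> space M" by blast
  have "\<exists>C>0. \<forall>f\<in>borel_measurable M. \<forall>R>0.
      Lnorm M \<alpha> (\<lambda>y. f y * indicator (B x R) y) \<le> ennreal C * fmean_norm d M q p \<alpha> f"
  proof (cases "q = \<alpha>")
    case True
    then show ?thesis using Lnorm_B_le_fmean_norm_same[OF x q(1) p] by simp
  next
    case False
    then have \<alpha>p: "\<alpha> = p" and "q \<noteq> \<infinity>" using eq q by (auto simp: top_unique)
    with q(1) obtain Q where Q: "1 \<le> Q" "q = ennreal Q" by (cases rule: exponent_cases) auto
    from p show ?thesis
    proof (cases rule: exponent_cases)
      case 1
      then show ?thesis using Lnorm_B_le_fmean_norm_top[OF x Q(1)] Q(2) \<alpha>p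
        by (intro exI[of _ 2]) auto
    next
      case (2 P)
      then show ?thesis using Lnorm_B_le_fmean_norm_finite[OF x Q(1) 2(1)] Q(2) \<alpha>p
        by (intro exI[of _ 2]) auto
    qed
  qed
  then obtain C where C: "C > 0" "\<And>f R. f \<in> borel_measurable M \<Longrightarrow> 0 < R \<Longrightarrow>
      Lnorm M \<alpha> (\<lambda>y. f y * indicator (B x R) y) \<le> ennreal C * fmean_norm d M q p \<alpha> f"
    by blast
  have "Lnorm M \<alpha> f \<le> ennreal C * fmean_norm d M q p \<alpha> f" if [measurable]: "f \<in> borel_measurable M" for f
  proof (rule Lnorm_le_exhaust[OF x \<alpha>])
    fix n :: nat
    have "Lnorm M \<alpha> (\<lambda>y. f y * indicator (B x (real n)) y) \<le> Lnorm M \<alpha> (\<lambda>y. f y * indicator (B x (real (Suc n))) y)"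
      using x \<alpha> B_mono[of "real n" "real (Suc n)" x] by (intro Lnorm_mono) (auto split: split_indicator)
    also have "\<dots> \<le> ennreal C * fmean_norm d M q p \<alpha> f" by (intro C(2)) auto
    finally show "Lnorm M \<alpha> (\<lambda>y. f y * indicator (B x (real n)) y) \<le> ennreal C * fmean_norm d M q p \<alpha> f" .
  qed simp
  with C(1) show ?thesis by blast
qed

text \<open>With \<open>Lnorm_cong_AE\<close>, this reduces the estimate to Borel functions: the modulus of a function
  that is measurable for the completion agrees almost everywhere with a Borel function.\<close>
lemma fmean_norm_cong_AE:
  assumes f: "f \<in> borel_measurable (completion M)" and g: "g \<in> borel_measurable (completion M)"
    and AE: "AE x in M. norm (f x) = norm (g x)"
  shows "fmean_norm d M q p \<alpha> f = fmean_norm d M q p \<alpha> g"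
proof -
  have [measurable]: "B y r \<in> sets (completion M)" if "y \<in> space M" for y r
    using that by (intro sets_completionI_sets) simp
  have "Lnorm M q (\<lambda>x. f x * indicator (B y r) x) = Lnorm M q (\<lambda>x. g x * indicator (B y r) x)"
    if "y \<in> space M" for y r
    using that f g AE by (intro Lnorm_cong_AE) (auto simp: norm_mult)
  then have "fmean_norm_at d M r q p \<alpha> f = fmean_norm_at d M r q p \<alpha> g" for r
    by (simp add: fmean_norm_at_def cong: nn_integral_cong SUP_cong)
  then show ?thesis by (simp add: fmean_norm_def)
qed

end

theorem theorem2p9:
  fixes d :: "'a \<Rightarrow> 'a \<Rightarrow> real" and M :: "'a measure" and q \<alpha> p :: ennreal
  assumes "homogeneous_type_space d M"
    and "1 \<le> q" and "q \<le> \<alpha>" and "\<alpha> \<le> p"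
    and "q = \<alpha> \<or> \<alpha> = p"
  shows "\<exists>C::real. C > 0 \<and>
    (\<forall>f \<in> borel_measurable (completion M).
       Lnorm M \<alpha> f \<le> ennreal C * fmean_norm d M q p \<alpha> f)"
proof -
  interpret homogeneous_type_space d M by fact
  obtain C where C: "C > 0" "\<And>f. f \<in> borel_measurable M \<Longrightarrow> Lnorm M \<alpha> f \<le> ennreal C * fmean_norm d M q p \<alpha> f"
    using Lnorm_le_fmean_norm[OF assms(2-5)] by blast
  have "Lnorm M \<alpha> f \<le> ennreal C * fmean_norm d M q p \<alpha> f"
    if f: "f \<in> borel_measurable (completion M)" for f
  proof -
    have "(\<lambda>x. norm (f x)) \<in> borel_measurable (completion M)" using f by measurable
    then obtain g where g: "g \<in> borel_measurable M" "AE x in M. norm (f x) = g x"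
      using completion_ex_borel_measurable_real by blast
    define h where "h x = complex_of_real (g x)" for x
    have h: "h \<in> borel_measurable M" using g(1) unfolding h_def by measurable
    then have h': "h \<in> borel_measurable (completion M)" by (rule measurable_completion)
    have AE: "AE x in M. norm (f x) = norm (h x)"
      using g(2)
    proof eventually_elim
      case (elim x)
      then have "0 \<le> g x" using norm_ge_zero[of "f x"] by linarith
      with elim show ?case by (simp add: h_def)
    qed
    show ?thesis
      using C(2)[OF h] Lnorm_cong_AE[OF f h' AE] fmean_norm_cong_AE[OF f h' AE] by simp
  qed
  with C(1) show ?thesis by blast
qed

end
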